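(* (Weighted projective Nullstellensatz.) Let $k$ be an algebraically closed field, let $a=(a_0,\ldots,a_n)$ be positive integers, and let $I$ be a weighted-homogeneous relevant ideal of $k_a[x_0,\ldots,x_n]$. Then $$\mathbb{I}(\mathbb{V}(I))=\operatorname{rad}(I).$$
   Context: $k_a[x_0,\ldots,x_n]$ is the polynomial ring graded by $\deg x_i=a_i$. A polynomial is weighted-homogeneous if it is homogeneous for this grading; an ideal is weighted-homogeneous if it is generated by weighted-homogeneous elements. $\mathbb{P}(a_0,\ldots,a_n)=(k^{n+1}\setminus\{0\})/k^\times$ with action $\lambda\cdot(x_0,\ldots,x_n)=(\lambda^{a_0}x_0,\ldots,\lambda^{a_n}x_n)$. For a weighted-homogeneous ideal $I$, $\mathbb{V}(I)\subseteq\mathbb{P}(a_0,\ldots,a_n)$ is the set of points $p$ with $f(\hat p)=0$ for all $f\in I$, where $\hat p$ is a representative of $p$ (the condition does not depend on the representative). For $V\subseteq\mathbb{P}(a_0,\ldots,a_n)$, $\mathbb{I}(V)$ is the ideal generated by all weighted-homogeneous polynomials vanishing at every point of $V$. An ideal $I$ is relevant if it is strictly contained in $(x_0,\ldots,x_n)$ and $\mathbb{V}(I)\neq\varnothing$. *)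

theory Defs
  imports
    "HOL-Analysis.Finite_Cartesian_Product"
    "HOL-Library.Poly_Mapping"
    "HOL-Computational_Algebra.Polynomial"
begin

section \<open>Polynomials in finitely many variables\<close>

text \<open>
  The variables are indexed by a finite (hence nonempty) type \<open>'n\<close>; the variables
  \<open>x\<^sub>0, \<dots>, x\<^sub>n\<close> correspond to \<open>CARD('n) = n + 1\<close>. Monomials are exponent vectors, and the
  ring structure on the type below is the convolution product of \<open>Poly_Mapping\<close>.
\<close>

type_synonym ('n, 'k) mvpoly = "('n \<Rightarrow>\<^sub>0 nat) \<Rightarrow>\<^sub>0 'k"

definition var :: "'n \<Rightarrow> ('n, 'k::comm_ring_1) mvpoly"
  where "var i = Poly_Mapping.single (Poly_Mapping.single i 1) 1"

definition monom_eval :: "'k::comm_ring_1 ^ 'n \<Rightarrow> ('n::finite \<Rightarrow>\<^sub>0 nat) \<Rightarrow> 'k"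
  where "monom_eval x m = (\<Prod>i\<in>UNIV. (x $ i) ^ Poly_Mapping.lookup m i)"

definition mv_eval :: "('n::finite, 'k::comm_ring_1) mvpoly \<Rightarrow> 'k ^ 'n \<Rightarrow> 'k"
  where "mv_eval f x = (\<Sum>m\<in>Poly_Mapping.keys f. Poly_Mapping.lookup f m * monom_eval x m)"


section \<open>Ideals\<close>

text \<open>
  Ideals of a commutative ring are its submodules when it is viewed as a module over itself:
  \<open>ring_ideal.span S\<close> is the ideal generated by \<open>S\<close>.
\<close>

global_interpretation ring_ideal: module "(*) :: 'a::comm_ring_1 \<Rightarrow> 'a \<Rightarrow> 'a"
  by unfold_locales (simp_all add: algebra_simps)

definition radical :: "'a::comm_ring_1 set \<Rightarrow> 'a set"
  where "radical I = {f. \<exists>m::nat. m > 0 \<and> f ^ m \<in> I}"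


section \<open>The weighted grading\<close>

definition weighted_degree :: "('n::finite \<Rightarrow> nat) \<Rightarrow> ('n \<Rightarrow>\<^sub>0 nat) \<Rightarrow> nat"
  where "weighted_degree a m = (\<Sum>i\<in>UNIV. a i * Poly_Mapping.lookup m i)"

text \<open>The zero polynomial counts as homogeneous (of every degree).\<close>

definition weighted_homogeneous_of_degree ::
    "('n::finite \<Rightarrow> nat) \<Rightarrow> nat \<Rightarrow> ('n, 'k::comm_ring_1) mvpoly \<Rightarrow> bool"
  where "weighted_homogeneous_of_degree a d f \<longleftrightarrow>
    (\<forall>m\<in>Poly_Mapping.keys f. weighted_degree a m = d)"

definition weighted_homogeneous ::
    "('n::finite \<Rightarrow> nat) \<Rightarrow> ('n, 'k::comm_ring_1) mvpoly \<Rightarrow> bool"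
  where "weighted_homogeneous a f \<longleftrightarrow> (\<exists>d. weighted_homogeneous_of_degree a d f)"

definition weighted_homogeneous_ideal ::
    "('n::finite \<Rightarrow> nat) \<Rightarrow> ('n, 'k::comm_ring_1) mvpoly set \<Rightarrow> bool"
  where "weighted_homogeneous_ideal a I \<longleftrightarrow>
    (\<exists>S. (\<forall>f\<in>S. weighted_homogeneous a f) \<and> I = ring_ideal.span S)"


section \<open>Weighted projective space\<close>

definition weighted_scale :: "('n::finite \<Rightarrow> nat) \<Rightarrow> 'k::field \<Rightarrow> 'k ^ 'n \<Rightarrow> 'k ^ 'n"
  where "weighted_scale a c x = (\<chi> i. c ^ a i * x $ i)"

definition weighted_orbit_rel :: "('n::finite \<Rightarrow> nat) \<Rightarrow> (('k::field ^ 'n) \<times> ('k ^ 'n)) set"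
  where "weighted_orbit_rel a =
    {(x, y). x \<noteq> 0 \<and> y \<noteq> 0 \<and> (\<exists>c. c \<noteq> 0 \<and> y = weighted_scale a c x)}"

definition weighted_proj_space :: "('n::finite \<Rightarrow> nat) \<Rightarrow> ('k::field ^ 'n) set set"
  where "weighted_proj_space a = (UNIV - {0}) // weighted_orbit_rel a"

text \<open>
  A point of weighted projective space is the set of its representatives. Vanishing is required
  at all representatives; the lemmas \<open>vanishes_at_iff\<close> and \<open>in_zero_locus_iff\<close> below show that
  testing a single representative gives the same notion.
\<close>

definition vanishes_at :: "('n::finite, 'k::field) mvpoly \<Rightarrow> ('k ^ 'n) set \<Rightarrow> bool"
  where "vanishes_at f p \<longleftrightarrow> (\<forall>x\<in>p. mv_eval f x = 0)"

definition zero_locus ::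
    "('n::finite \<Rightarrow> nat) \<Rightarrow> ('n, 'k::field) mvpoly set \<Rightarrow> ('k ^ 'n) set set"
  where "zero_locus a I = {p \<in> weighted_proj_space a. \<forall>f\<in>I. vanishes_at f p}"

definition vanishing_ideal ::
    "('n::finite \<Rightarrow> nat) \<Rightarrow> ('k::field ^ 'n) set set \<Rightarrow> ('n, 'k) mvpoly set"
  where "vanishing_ideal a V =
    ring_ideal.span {f. weighted_homogeneous a f \<and> (\<forall>p\<in>V. vanishes_at f p)}"

definition relevant_ideal ::
    "('n::finite \<Rightarrow> nat) \<Rightarrow> ('n, 'k::field) mvpoly set \<Rightarrow> bool"
  where "relevant_ideal a I \<longleftrightarrow>
    I \<subset> ring_ideal.span (range var) \<and> zero_locus a I \<noteq> {}"


section \<open>Independence of the representative\<close>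

lemma equiv_weighted_orbit_rel: "equiv (UNIV - {0}) (weighted_orbit_rel a)"
proof (rule equivI)
  show "weighted_orbit_rel a \<subseteq> (UNIV - {0}) \<times> (UNIV - {0})"
    by (auto simp: weighted_orbit_rel_def)
  show "refl_on (UNIV - {0}) (weighted_orbit_rel a)"
    by (auto simp: refl_on_def weighted_orbit_rel_def weighted_scale_def intro!: exI[of _ 1])
  show "sym (weighted_orbit_rel a)"
  proof (rule symI)
    fix x y assume "(x, y) \<in> weighted_orbit_rel a"
    then obtain c where "x \<noteq> 0" "y \<noteq> 0" "c \<noteq> 0" "y = weighted_scale a c x"
      by (auto simp: weighted_orbit_rel_def)
    moreover from this have "x = weighted_scale a (inverse c) y"
      by (simp add: weighted_scale_def vec_eq_iff power_inverse)
    ultimately show "(y, x) \<in> weighted_orbit_rel a"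
      unfolding weighted_orbit_rel_def using nonzero_imp_inverse_nonzero by blast
  qed
  show "trans (weighted_orbit_rel a)"
  proof (rule transI)
    fix x y z assume "(x, y) \<in> weighted_orbit_rel a" "(y, z) \<in> weighted_orbit_rel a"
    then obtain c d where nz: "x \<noteq> 0" "z \<noteq> 0" "c \<noteq> 0" "d \<noteq> 0"
      and y: "y = weighted_scale a c x" and z: "z = weighted_scale a d y"
      by (auto simp: weighted_orbit_rel_def)
    have "z = weighted_scale a (d * c) x"
      unfolding z y weighted_scale_def
      by (simp only: vec_eq_iff vec_lambda_beta power_mult_distrib mult.assoc) simp
    moreover have "d * c \<noteq> 0" using nz by simp
    ultimately show "(x, z) \<in> weighted_orbit_rel a"
      using nz unfolding weighted_orbit_rel_def by blast
  qed
qed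

lemma monom_eval_weighted_scale:
  "monom_eval (weighted_scale a c x) m = c ^ weighted_degree a m * monom_eval x m"
  by (simp add: monom_eval_def weighted_scale_def weighted_degree_def power_mult_distrib
      prod.distrib power_sum power_mult)

lemma mv_eval_weighted_scale:
  assumes "weighted_homogeneous_of_degree a d f"
  shows "mv_eval f (weighted_scale a c x) = c ^ d * mv_eval f x"
  using assms
  by (auto simp: mv_eval_def monom_eval_weighted_scale weighted_homogeneous_of_degree_def
      sum_distrib_left intro!: sum.cong)

lemma weighted_proj_space_related:
  assumes "p \<in> weighted_proj_space a" "x \<in> p" "y \<in> p"
  obtains c where "c \<noteq> 0" "y = weighted_scale a c x"
proof -
  have "(x, y) \<in> weighted_orbit_rel a"
    using in_quotient_imp_in_rel[OF equiv_weighted_orbit_rel, of p a x y] assms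
    by (simp add: weighted_proj_space_def)
  then show ?thesis using that by (auto simp: weighted_orbit_rel_def)
qed

lemma vanishes_at_iff:
  assumes "p \<in> weighted_proj_space a" "x \<in> p" "weighted_homogeneous a f"
  shows "vanishes_at f p \<longleftrightarrow> mv_eval f x = 0"
proof
  assume 0: "mv_eval f x = 0"
  obtain d where d: "weighted_homogeneous_of_degree a d f"
    using assms(3) by (auto simp: weighted_homogeneous_def)
  show "vanishes_at f p"
    unfolding vanishes_at_def
  proof
    fix y assume "y \<in> p"
    then obtain c where "y = weighted_scale a c x"
      using weighted_proj_space_related[OF assms(1,2)] by blast
    then show "mv_eval f y = 0" using mv_eval_weighted_scale[OF d] 0 by simp
  qed
qed (use assms(2) in \<open>auto simp: vanishes_at_def\<close>)

lemma mv_eval_superset: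
  assumes "finite A" "Poly_Mapping.keys f \<subseteq> A"
  shows "mv_eval f x = (\<Sum>m\<in>A. Poly_Mapping.lookup f m * monom_eval x m)"
  unfolding mv_eval_def using assms
  by (intro sum.mono_neutral_left) (auto simp: in_keys_iff)

lemma mv_eval_zero [simp]: "mv_eval 0 x = 0"
  by (simp add: mv_eval_def)

lemma mv_eval_single [simp]: "mv_eval (Poly_Mapping.single m c) x = c * monom_eval x m"
  by (cases "c = 0") (simp_all add: mv_eval_def)

lemma mv_eval_var [simp]: "mv_eval (var i) x = x $ i"
proof -
  have "monom_eval x (Poly_Mapping.single i 1) = (\<Prod>j\<in>UNIV. if i = j then x $ j else 1)"
    unfolding monom_eval_def by (intro prod.cong) (auto simp: lookup_single when_def)
  then show ?thesis by (simp add: var_def)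
qed

lemma mv_eval_add: "mv_eval (f + g) x = mv_eval f x + mv_eval g x"
proof -
  let ?A = "Poly_Mapping.keys f \<union> Poly_Mapping.keys g"
  have "mv_eval h x = (\<Sum>m\<in>?A. Poly_Mapping.lookup h m * monom_eval x m)"
    if "h \<in> {f, g, f + g}" for h
    using that Poly_Mapping.keys_add[of f g] by (intro mv_eval_superset) auto
  then show ?thesis by (simp add: lookup_add sum.distrib distrib_right)
qed

lemma monom_eval_add: "monom_eval x (m + m') = monom_eval x m * monom_eval x m'"
  by (simp add: monom_eval_def lookup_add power_add prod.distrib)

lemma mvpoly_induct [case_names zero add]:
  fixes f :: "('n, 'k::comm_ring_1) mvpoly"
  assumes "P 0" and "\<And>f m c. P f \<Longrightarrow> P (f + Poly_Mapping.single m c)"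
  shows "P f"
proof (induction f rule: update_induct)
  case (update f m c)
  have "Poly_Mapping.update m c f = f + Poly_Mapping.single m c"
    using update.hyps
    by (intro poly_mapping_eqI)
      (auto simp: lookup_update lookup_add lookup_single when_def in_keys_iff)
  then show ?case using assms(2) update.IH by metis
qed (use assms(1) in simp)

lemma mv_eval_mult_single:
  "mv_eval (Poly_Mapping.single m c * g) x = c * monom_eval x m * mv_eval g x"
proof (induction g rule: mvpoly_induct)
  case (add g m' c')
  have "mv_eval (Poly_Mapping.single m c * Poly_Mapping.single m' c') x
      = c * monom_eval x m * mv_eval (Poly_Mapping.single m' c') x"
    by (simp only: mult_single mv_eval_single monom_eval_add ac_simps)
  with add show ?case by (simp only: distrib_left mv_eval_add)
qed simp

lemma mv_eval_mult: "mv_eval (f * g) x = mv_eval f x * mv_eval g x"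
proof (induction f rule: mvpoly_induct)
  case (add f m c)
  then show ?case by (simp add: mv_eval_mult_single mv_eval_add distrib_right)
qed simp

lemma in_zero_locus_iff:
  assumes "p \<in> weighted_proj_space a" "x \<in> p" "weighted_homogeneous_ideal a I"
  shows "p \<in> zero_locus a I \<longleftrightarrow> (\<forall>f\<in>I. mv_eval f x = 0)"
proof
  assume 0: "\<forall>f\<in>I. mv_eval f x = 0"
  obtain S where S: "\<And>f. f \<in> S \<Longrightarrow> weighted_homogeneous a f" "I = ring_ideal.span S"
    using assms(3) by (auto simp: weighted_homogeneous_ideal_def)
  have "mv_eval f y = 0" if "y \<in> p" "f \<in> I" for f y
    using that(2) unfolding S(2)
  proof (induction rule: ring_ideal.span_induct_alt)
    case (step c g h)
    have "mv_eval g x = 0" using 0 step.hyps by (simp add: S(2) ring_ideal.span_base)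
    then have "vanishes_at g p" using vanishes_at_iff[OF assms(1,2) S(1)] step.hyps by simp
    then show ?case using step that(1) by (simp add: mv_eval_add mv_eval_mult vanishes_at_def)
  qed simp
  then show "p \<in> zero_locus a I"
    using assms(1) by (auto simp: zero_locus_def vanishes_at_def)
qed (use assms(2) in \<open>auto simp: zero_locus_def vanishes_at_def\<close>)

end

theory Submission
  imports Defs
begin

text \<open>
  An element outside a prime ideal \<open>P\<close> of the polynomial ring is moved away from the zero locus
  of \<open>P\<close> by eliminating the variables one at a time: if \<open>u \<in> B[t]\<close> is not in \<open>P\<close>, then some
  \<open>v \<in> B\<close> outside \<open>P\<close> has the property that every evaluation of \<open>B\<close> that kills \<open>P \<inter> B\<close> but not
  \<open>v\<close> extends to \<open>B[t]\<close>, killing \<open>P \<inter> B[t]\<close> but not \<open>u\<close>. Once no variable is left, \<open>v\<close> is a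
  nonzero constant. Choosing \<open>P \<supseteq> I\<close> maximal among the ideals avoiding the powers of \<open>f\<close> gives the
  affine Nullstellensatz. The projective statement follows, since the homogeneous components of a
  polynomial vanishing on an orbit are the coefficients of a one-variable polynomial in the scaling
  factor, and since homogeneous polynomials vanishing at a point of \<open>\<V>(I) \<noteq> \<emptyset>\<close> also vanish at
  the origin.
\<close>

section \<open>Polynomials over a subring\<close>

definition subring :: "'a::comm_ring_1 set \<Rightarrow> bool"
  where "subring B \<longleftrightarrow> 1 \<in> B \<and> (\<forall>x\<in>B. \<forall>y\<in>B. x - y \<in> B \<and> x * y \<in> B)"

text \<open>This is B[T] inside \<open>'a poly\<close>. The elements of B[t] are the values
  \<open>poly q t\<close>, so relations of \<open>t\<close> over \<open>B\<close> become polynomials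
  with a degree.\<close>

definition polys_over :: "'a::comm_ring_1 set \<Rightarrow> 'a poly set"
  where "polys_over B = {q. \<forall>j. coeff q j \<in> B}"

lemma
  assumes "subring B"
  shows subring_0: "0 \<in> B"
    and subring_1: "1 \<in> B"
    and subring_diff: "x \<in> B \<Longrightarrow> y \<in> B \<Longrightarrow> x - y \<in> B"
    and subring_mult: "x \<in> B \<Longrightarrow> y \<in> B \<Longrightarrow> x * y \<in> B"
    and subring_add: "x \<in> B \<Longrightarrow> y \<in> B \<Longrightarrow> x + y \<in> B"
    and subring_power: "x \<in> B \<Longrightarrow> x ^ m \<in> B"
proof -
  show 1: "1 \<in> B" and diff: "\<And>x y. x \<in> B \<Longrightarrow> y \<in> B \<Longrightarrow> x - y \<in> B"
    and mult: "\<And>x y. x \<in> B \<Longrightarrow> y \<in> B \<Longrightarrow> x * y \<in> B"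
    using assms by (auto simp: subring_def)
  show 0: "0 \<in> B" using diff[OF 1 1] by simp
  show "x \<in> B \<Longrightarrow> y \<in> B \<Longrightarrow> x + y \<in> B"
    using diff[of x "0 - y"] diff[OF 0, of y] by simp
  show "x \<in> B \<Longrightarrow> x ^ m \<in> B"
    by (induction m) (auto intro: 1 mult)
qed

lemma subring_sum:
  assumes "subring B" "\<And>i. i \<in> A \<Longrightarrow> f i \<in> B"
  shows "sum f A \<in> B"
  using assms(2)
  by (induction A rule: infinite_finite_induct)
    (auto intro: subring_0[OF assms(1)] subring_add[OF assms(1)])

lemma
  assumes "subring B"
  shows polys_over_0: "0 \<in> polys_over B"
    and polys_over_const: "c \<in> B \<Longrightarrow> [:c:] \<in> polys_over B"
    and polys_over_monom: "c \<in> B \<Longrightarrow> monom c m \<in> polys_over B"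
    and polys_over_add: "p \<in> polys_over B \<Longrightarrow> q \<in> polys_over B \<Longrightarrow> p + q \<in> polys_over B"
    and polys_over_diff: "p \<in> polys_over B \<Longrightarrow> q \<in> polys_over B \<Longrightarrow> p - q \<in> polys_over B"
    and polys_over_mult: "p \<in> polys_over B \<Longrightarrow> q \<in> polys_over B \<Longrightarrow> p * q \<in> polys_over B"
    and polys_over_smult: "c \<in> B \<Longrightarrow> q \<in> polys_over B \<Longrightarrow> smult c q \<in> polys_over B"
  using assms
  by (auto simp: polys_over_def coeff_mult coeff_pCons split: nat.split
      intro: subring_0 subring_add subring_diff subring_mult intro!: subring_sum)

text \<open>The library's pseudo-division does not record the ring generated by the coefficients.\<close>

lemma pseudo_division_over:
  assumes B: "subring B" and q: "q \<in> polys_over B" and p: "p \<in> polys_over B"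
  obtains N s r where "smult (lead_coeff q ^ N) p = q * s + r"
    "s \<in> polys_over B" "r \<in> polys_over B"
    "degree s \<le> degree p - degree q" "r = 0 \<or> degree r < degree q"
proof -
  have "\<exists>N s r. smult (lead_coeff q ^ N) p = q * s + r \<and> s \<in> polys_over B \<and> r \<in> polys_over B
    \<and> degree s \<le> degree p - degree q \<and> (r = 0 \<or> degree r < degree q)"
    using p
  proof (induction "degree p" arbitrary: p rule: less_induct)
    case less
    let ?b = "lead_coeff q"
    consider "degree p < degree q" | "degree p = 0" "degree q = 0" | "degree q \<le> degree p" "degree p > 0"
      by linarith
    then show ?case
    proof cases
      case 1
      then show ?thesis
        using less.prems polys_over_0[OF B] by (intro exI[of _ 0] exI[of _ "0::'a poly"] exI[of _ p]) auto
    next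
      \<comment> \<open>No degree can drop below 0 here: the constant divisor \<open>[:b:]\<close>
        has quotient \<open>p\<close> and remainder 0 after one multiplication by
        \<open>b\<close>.\<close>
      case 2
      then obtain b where "q = [:b:]" by (metis degree_eq_zeroE)
      with 2 show ?thesis
        using less.prems polys_over_0[OF B]
        by (intro exI[of _ 1] exI[of _ p] exI[of _ "0::'a poly"]) auto
    next
      case 3
      define h where "h = monom (lead_coeff p) (degree p - degree q)"
      define p' where "p' = smult ?b p - q * h"
      have h: "h \<in> polys_over B"
        using less.prems unfolding h_def by (intro polys_over_monom[OF B]) (simp add: polys_over_def)
      have dh: "degree h \<le> degree p - degree q"
        by (simp add: h_def degree_monom_le)
      have b: "?b \<in> B" using q by (simp add: polys_over_def)
      have p': "p' \<in> polys_over B"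
        unfolding p'_def using B b q h less.prems
        by (intro polys_over_diff polys_over_smult polys_over_mult) auto
      have "degree p' \<le> degree p"
        unfolding p'_def using dh 3 degree_mult_le[of q h] degree_smult_le[of ?b p]
        by (intro degree_diff_le) linarith+
      moreover have "coeff p' (degree p) = 0"
        using 3 by (simp add: p'_def h_def mult.commute[of q] coeff_monom_mult)
      ultimately have dp': "degree p' < degree p"
        using 3 by (metis degree_0 eq_zero_or_degree_less)
      from less.hyps[OF this p'] obtain N s r where IH: "smult (?b ^ N) p' = q * s + r"
        "s \<in> polys_over B" "r \<in> polys_over B"
        "degree s \<le> degree p' - degree q" "r = 0 \<or> degree r < degree q" by blast
      have "smult (?b ^ Suc N) p = smult (?b ^ N) p' + q * smult (?b ^ N) h"
        by (simp add: p'_def smult_diff_right mult.commute)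
      then have "smult (?b ^ Suc N) p = q * (s + smult (?b ^ N) h) + r"
        by (simp add: IH(1) distrib_left)
      moreover have "s + smult (?b ^ N) h \<in> polys_over B"
        using B b h IH(2) by (intro polys_over_add polys_over_smult subring_power) auto
      moreover have "degree (s + smult (?b ^ N) h) \<le> degree p - degree q"
        using IH(4) dp' dh degree_smult_le[of "?b ^ N" h] by (intro degree_add_le) linarith+
      ultimately show ?thesis using IH(3,5) by blast
    qed
  qed
  then show ?thesis using that by blast
qed


section \<open>Prime ideals\<close>

definition prime_ideal :: "'a::comm_ring_1 set \<Rightarrow> bool"
  where "prime_ideal P \<longleftrightarrow> ring_ideal.subspace P \<and> 1 \<notin> P \<and>
    (\<forall>x y. x * y \<in> P \<longrightarrow> x \<in> P \<or> y \<in> P)"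

lemma
  assumes "prime_ideal P"
  shows prime_ideal_0: "0 \<in> P"
    and prime_ideal_1: "1 \<notin> P"
    and prime_ideal_add: "x \<in> P \<Longrightarrow> y \<in> P \<Longrightarrow> x + y \<in> P"
    and prime_ideal_diff: "x \<in> P \<Longrightarrow> y \<in> P \<Longrightarrow> x - y \<in> P"
    and prime_ideal_mult_left: "x \<in> P \<Longrightarrow> c * x \<in> P"
    and prime_ideal_mult_right: "x \<in> P \<Longrightarrow> x * c \<in> P"
    and prime_ideal_sum: "(\<And>i. i \<in> A \<Longrightarrow> f i \<in> P) \<Longrightarrow> sum f A \<in> P"
    and prime_ideal_mult_iff: "x * y \<in> P \<longleftrightarrow> x \<in> P \<or> y \<in> P"
proof -
  have P: "ring_ideal.subspace P" using assms by (simp add: prime_ideal_def)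
  show "0 \<in> P" "1 \<notin> P" "x \<in> P \<Longrightarrow> y \<in> P \<Longrightarrow> x + y \<in> P"
    "x \<in> P \<Longrightarrow> y \<in> P \<Longrightarrow> x - y \<in> P"
    using assms P ring_ideal.subspace_0 ring_ideal.subspace_add ring_ideal.subspace_diff
    by (auto simp: prime_ideal_def)
  show "(\<And>i. i \<in> A \<Longrightarrow> f i \<in> P) \<Longrightarrow> sum f A \<in> P"
    by (rule ring_ideal.subspace_sum[OF P])
  show mult: "\<And>c x. x \<in> P \<Longrightarrow> c * x \<in> P"
    using P ring_ideal.subspace_scale by blast
  show mult': "\<And>c x. x \<in> P \<Longrightarrow> x * c \<in> P" by (subst mult.commute) (rule mult)
  show "x * y \<in> P \<longleftrightarrow> x \<in> P \<or> y \<in> P"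
    using assms mult mult' by (auto simp: prime_ideal_def)
qed

lemma prime_ideal_power:
  assumes "prime_ideal P" "x ^ m \<in> P"
  shows "x \<in> P"
  using assms(2)
  by (induction m) (auto simp: prime_ideal_1[OF assms(1)] prime_ideal_mult_iff[OF assms(1)])

lemma poly_in_prime_ideal:
  assumes "prime_ideal P" "\<And>j. coeff q j \<in> P"
  shows "poly q t \<in> P"
  unfolding poly_altdef
  using assms by (intro prime_ideal_sum prime_ideal_mult_right) auto

text \<open>Leading terms with coefficient in \<open>P\<close> are removed one at a time, each
  changing the value at \<open>t\<close> by an element of \<open>P\<close>. The coefficient outside
  \<open>P\<close> is never removed, so the process stops. This gives a leading coefficient that is
  nonzero modulo \<open>P\<close> without forming a quotient ring.\<close>

lemma trim_mod_prime_ideal: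
  assumes P: "prime_ideal P" and B: "subring B" and q: "q \<in> polys_over B" and j: "coeff q j \<notin> P"
  obtains q' where "q' \<in> polys_over B" "lead_coeff q' \<notin> P" "degree q' \<le> degree q"
    "poly q' t - poly q t \<in> P"
proof -
  have "\<exists>q'. q' \<in> polys_over B \<and> lead_coeff q' \<notin> P \<and> degree q' \<le> degree q
    \<and> poly q' t - poly q t \<in> P"
    using q j
  proof (induction "degree q" arbitrary: q rule: less_induct)
    case less
    show ?case
    proof (cases "lead_coeff q \<in> P")
      case False
      then show ?thesis
        using less.prems prime_ideal_0[OF P] by (intro exI[of _ q]) auto
    next
      case True
      define h where "h = monom (lead_coeff q) (degree q)"
      have h: "h \<in> polys_over B"
        using less.prems unfolding h_def by (intro polys_over_monom[OF B]) (simp add: polys_over_def)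
      have ne: "j \<noteq> degree q" using True less.prems by auto
      have "degree q \<noteq> 0"
        using ne less.prems prime_ideal_0[OF P] by (metis coeff_eq_0 gr_zeroI)
      moreover have "degree (q - h) \<le> degree q"
        by (intro degree_diff_le) (auto simp: h_def degree_monom_le)
      moreover have "coeff (q - h) (degree q) = 0" by (simp add: h_def)
      ultimately have "degree (q - h) < degree q"
        by (metis bot_nat_0.not_eq_extremum degree_0 eq_zero_or_degree_less)
      moreover have "q - h \<in> polys_over B" using B less.prems h by (intro polys_over_diff) auto
      moreover have "coeff (q - h) j \<notin> P" using ne less.prems by (simp add: h_def)
      ultimately obtain q' where q': "q' \<in> polys_over B" "lead_coeff q' \<notin> P"
        "degree q' \<le> degree (q - h)" "poly q' t - poly (q - h) t \<in> P"
        using less.hyps by blast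
      have "poly h t \<in> P"
        using True P by (auto simp: h_def poly_monom intro: prime_ideal_mult_right)
      then have "poly q' t - poly (q - h) t - poly h t \<in> P"
        by (rule prime_ideal_diff[OF P q'(4)])
      then have "poly q' t - poly q t \<in> P" by simp
      then show ?thesis
        using q' \<open>degree (q - h) < degree q\<close> by (intro exI[of _ q']) auto
    qed
  qed
  then show ?thesis using that by blast
qed

text \<open>Zorn's lemma yields an ideal \<open>P\<close> maximal among those containing
  \<open>I\<close> and no power of \<open>f\<close>. It is prime: for \<open>x\<close>,
  \<open>y\<close> outside \<open>P\<close>, the ideals (P, x) and (P, y) each contain a power of
  \<open>f\<close>, and the product of the two powers lies in P + (xy).\<close>

lemma prime_ideal_avoiding_powers:
  assumes I: "ring_ideal.subspace I" and f: "\<And>m. f ^ m \<notin> I"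
  obtains P where "prime_ideal P" "I \<subseteq> P" "f \<notin> P"
proof -
  define \<A> where "\<A> = {J. ring_ideal.subspace J \<and> I \<subseteq> J \<and> (\<forall>m. f ^ m \<notin> J)}"
  have "\<exists>P\<in>\<A>. \<forall>X\<in>\<A>. P \<subseteq> X \<longrightarrow> X = P"
  proof (rule subset_Zorn_nonempty)
    show "\<A> \<noteq> {}" using I f by (auto simp: \<A>_def)
    fix \<C> assume ne: "\<C> \<noteq> {}" and ch: "subset.chain \<A> \<C>"
    then have sub: "\<And>J. J \<in> \<C> \<Longrightarrow> ring_ideal.subspace J \<and> I \<subseteq> J \<and> (\<forall>m. f ^ m \<notin> J)"
      by (auto simp: subset_chain_def \<A>_def)
    have "ring_ideal.subspace (\<Union>\<C>)"
    proof (rule ring_ideal.subspaceI)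
      show "0 \<in> \<Union>\<C>" using ne sub ring_ideal.subspace_0 by blast
      show "x + y \<in> \<Union>\<C>" if "x \<in> \<Union>\<C>" "y \<in> \<Union>\<C>" for x y
      proof -
        from that obtain J K where "J \<in> \<C>" "x \<in> J" "K \<in> \<C>" "y \<in> K" by blast
        moreover from this have "J \<subseteq> K \<or> K \<subseteq> J" using ch by (auto simp: subset_chain_def)
        ultimately show ?thesis using sub ring_ideal.subspace_add by blast
      qed
      show "c * x \<in> \<Union>\<C>" if "x \<in> \<Union>\<C>" for c x
        using that sub ring_ideal.subspace_scale by blast
    qed
    then show "\<Union>\<C> \<in> \<A>" using ne sub by (auto simp: \<A>_def)
  qed
  then obtain P where P: "ring_ideal.subspace P" "I \<subseteq> P" "\<And>m. f ^ m \<notin> P"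
    and max: "\<And>X. X \<in> \<A> \<Longrightarrow> P \<subseteq> X \<Longrightarrow> X = P"
    by (auto simp: \<A>_def)
  have spanP: "ring_ideal.span P = P" using P(1) by (simp add: ring_ideal.span_eq_iff)
  have power: "\<exists>m c. f ^ m - c * x \<in> P" if "x \<notin> P" for x
  proof -
    have "P \<subseteq> ring_ideal.span (insert x P)" "x \<in> ring_ideal.span (insert x P)"
      using ring_ideal.span_superset by blast+
    then have "ring_ideal.span (insert x P) \<notin> \<A>" using max that by blast
    then obtain m where "f ^ m \<in> ring_ideal.span (insert x P)"
      using \<open>P \<subseteq> _\<close> P(2) ring_ideal.subspace_span by (auto simp: \<A>_def)
    then show ?thesis by (auto simp: ring_ideal.span_breakdown_eq spanP)
  qed
  have "x \<in> P \<or> y \<in> P" if xy: "x * y \<in> P" for x y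
  proof (rule ccontr)
    assume "\<not> (x \<in> P \<or> y \<in> P)"
    then obtain m c n d where mn: "f ^ m - c * x \<in> P" "f ^ n - d * y \<in> P" using power by blast
    note add = ring_ideal.subspace_add[OF P(1)] and scale = ring_ideal.subspace_scale[OF P(1)]
    have "f ^ (m + n)
        = f ^ n * (f ^ m - c * x) + (c * x) * (f ^ n - d * y) + (c * d) * (x * y)"
      \<comment> \<open>the simp rule \<open>scale_scale\<close>, here associativity to the left, loops with \<open>algebra_simps\<close>\<close>
      unfolding power_add by (simp add: algebra_simps del: ring_ideal.scale_scale)
    also have "\<dots> \<in> P" by (rule add[OF add[OF scale[OF mn(1)] scale[OF mn(2)]] scale[OF xy]])
    finally show False using P(3) by blast
  qed
  \<comment> \<open>Exponent 0 gives that \<open>P\<close> is proper, exponent 1 that it avoids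
    \<open>f\<close>.\<close>
  then have "prime_ideal P" using P(1) P(3)[of 0] by (simp add: prime_ideal_def)
  then show ?thesis using that P(2) P(3)[of 1] by simp
qed


section \<open>Extension of homomorphisms into an algebraically closed field\<close>

definition ring_hom :: "('a::comm_ring_1 \<Rightarrow> 'b::comm_ring_1) \<Rightarrow> bool"
  where "ring_hom \<phi> \<longleftrightarrow> \<phi> 1 = 1 \<and> (\<forall>x y. \<phi> (x + y) = \<phi> x + \<phi> y \<and> \<phi> (x * y) = \<phi> x * \<phi> y)"

lemma
  assumes "ring_hom \<phi>"
  shows ring_hom_0: "\<phi> 0 = 0"
    and ring_hom_add: "\<phi> (x + y) = \<phi> x + \<phi> y"
    and ring_hom_mult: "\<phi> (x * y) = \<phi> x * \<phi> y"
    and ring_hom_diff: "\<phi> (x - y) = \<phi> x - \<phi> y"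
    and ring_hom_power: "\<phi> (x ^ m) = \<phi> x ^ m"
    and ring_hom_sum: "\<phi> (sum f A) = (\<Sum>i\<in>A. \<phi> (f i))"
proof -
  show add: "\<And>x y. \<phi> (x + y) = \<phi> x + \<phi> y"
    and mult: "\<And>x y. \<phi> (x * y) = \<phi> x * \<phi> y"
    using assms by (auto simp: ring_hom_def)
  have 1: "\<phi> 1 = 1" using assms by (simp add: ring_hom_def)
  show 0: "\<phi> 0 = 0" using add[of 0 0] by simp
  show "\<phi> (x - y) = \<phi> x - \<phi> y" using add[of "x - y" y] by simp
  show "\<phi> (x ^ m) = \<phi> x ^ m" by (induction m) (auto simp: 1 mult)
  show "\<phi> (sum f A) = (\<Sum>i\<in>A. \<phi> (f i))"
    by (induction A rule: infinite_finite_induct) (auto simp: 0 add)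
qed

lemma
  assumes "ring_hom \<phi>"
  shows map_poly_hom_add: "map_poly \<phi> (p + q) = map_poly \<phi> p + map_poly \<phi> q"
    and map_poly_hom_diff: "map_poly \<phi> (p - q) = map_poly \<phi> p - map_poly \<phi> q"
    and map_poly_hom_mult: "map_poly \<phi> (p * q) = map_poly \<phi> p * map_poly \<phi> q"
    and map_poly_hom_smult: "map_poly \<phi> (smult c q) = smult (\<phi> c) (map_poly \<phi> q)"
  using assms
  by (auto intro!: poly_eqI simp: coeff_map_poly coeff_mult ring_hom_0 ring_hom_add ring_hom_diff
      ring_hom_mult ring_hom_sum)

lemma ring_hom_poly:
  assumes "ring_hom \<phi>"
  shows "\<phi> (poly q t) = poly (map_poly \<phi> q) (\<phi> t)"
  using assms
  by (induction q)
    (simp_all add: map_poly_pCons ring_hom_0 ring_hom_add ring_hom_mult)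

text \<open>Over a finite field, 1 plus the product of all T - a takes the value 1 everywhere
  although its degree is positive.\<close>

lemma infinite_UNIV_alg_closed_field: "infinite (UNIV :: 'k::alg_closed_field set)"
proof
  assume fin: "finite (UNIV :: 'k set)"
  define p where "p = (\<Prod>a\<in>UNIV. [:- a, 1 :: 'k:])"
  have "degree p = CARD('k)" by (simp add: p_def degree_prod_sum_eq)
  then have "degree (p + 1) > 0"
    using fin by (simp add: degree_add_eq_left finite_UNIV_card_ge_0)
  then obtain z where "poly (p + 1) z = 0" using alg_closed_imp_poly_has_root by blast
  moreover have "poly p z = 0" using fin by (auto simp: p_def poly_prod)
  ultimately show False by simp
qed

text \<open>The extension is given by \<open>t0\<close>, the image chosen for \<open>t\<close>. The
  proof imitates field theory over Frac(B/P): for transcendental \<open>t\<close>, any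
  \<open>t0\<close> off finitely many roots will do; for algebraic \<open>t\<close>,
  \<open>t0\<close> is a root of the image of a minimal polynomial, and U(t) divides a nonzero
  constant modulo \<open>P\<close>. Denominators are cleared throughout, and \<open>v\<close>
  collects the coefficients that \<phi> must not kill.\<close>

lemma extend_hom_to_adjunction:
  fixes t :: "'a::comm_ring_1"
  assumes B: "subring B" and P: "prime_ideal P"
    and U: "U \<in> polys_over B" and u: "poly U t \<notin> P"
  obtains v where "v \<in> B" "v \<notin> P"
    "\<And>\<phi> :: 'a \<Rightarrow> 'k::alg_closed_field. ring_hom \<phi> \<Longrightarrow>
      (\<And>b. b \<in> B \<Longrightarrow> b \<in> P \<Longrightarrow> \<phi> b = 0) \<Longrightarrow> \<phi> v \<noteq> 0 \<Longrightarrow>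
      \<exists>t0. (\<forall>q\<in>polys_over B. poly q t \<in> P \<longrightarrow> poly (map_poly \<phi> q) t0 = 0)
        \<and> poly (map_poly \<phi> U) t0 \<noteq> 0"
proof (cases "\<forall>q\<in>polys_over B. poly q t \<in> P \<longrightarrow> (\<forall>j. coeff q j \<in> P)")
  case transcendental: True
  obtain j where j: "coeff U j \<notin> P" using poly_in_prime_ideal[OF P] u by blast
  show ?thesis
  proof (rule that[of "coeff U j"])
    show "coeff U j \<in> B" using U by (simp add: polys_over_def)
    show "coeff U j \<notin> P" by fact
    fix \<phi> :: "'a \<Rightarrow> 'k"
    assume \<phi>: "ring_hom \<phi>" and ker: "\<And>b. b \<in> B \<Longrightarrow> b \<in> P \<Longrightarrow> \<phi> b = 0" and v: "\<phi> (coeff U j) \<noteq> 0"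
    have "map_poly \<phi> U \<noteq> 0"
      using v ring_hom_0[OF \<phi>] by (metis coeff_0 coeff_map_poly)
    then have "finite {x. poly (map_poly \<phi> U) x = 0}" by (rule poly_roots_finite)
    then obtain t0 where t0: "poly (map_poly \<phi> U) t0 \<noteq> 0"
      using infinite_UNIV_alg_closed_field by (metis (mono_tags) UNIV_eq_I mem_Collect_eq)
    have "map_poly \<phi> q = 0" if "q \<in> polys_over B" "poly q t \<in> P" for q
      using that transcendental ker
      by (intro poly_eqI) (auto simp: coeff_map_poly ring_hom_0[OF \<phi>] polys_over_def)
    with t0 show "\<exists>t0. (\<forall>q\<in>polys_over B. poly q t \<in> P \<longrightarrow> poly (map_poly \<phi> q) t0 = 0)
        \<and> poly (map_poly \<phi> U) t0 \<noteq> 0" by auto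
  qed
next
  case algebraic: False
  \<comment> \<open>These are the relations of \<open>t\<close> modulo \<open>P\<close> with leading
    coefficient outside \<open>P\<close>. One of least degree, \<open>p\<close>, stands in for the
    minimal polynomial of \<open>t\<close> over Frac(B/P).\<close>
  define W where "W = {q \<in> polys_over B. poly q t \<in> P \<and> lead_coeff q \<notin> P}"
  have trimW: "\<exists>r'\<in>W. degree r' \<le> degree r"
    if "r \<in> polys_over B" "poly r t \<in> P" "coeff r j \<notin> P" for r j
  proof -
    obtain r' where "r' \<in> polys_over B" "lead_coeff r' \<notin> P" "degree r' \<le> degree r"
      "poly r' t - poly r t \<in> P"
      using trim_mod_prime_ideal[OF P B \<open>r \<in> _\<close> \<open>coeff r j \<notin> P\<close>] by blast
    moreover from this(4) have "poly r' t \<in> P"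
      using prime_ideal_add[OF P _ \<open>poly r t \<in> P\<close>, of "poly r' t - poly r t"] by simp
    ultimately show ?thesis by (auto simp: W_def)
  qed
  then have "\<exists>q. q \<in> W" using algebraic by blast
  then obtain p where pW: "p \<in> W" and p_least: "\<And>q. q \<in> W \<Longrightarrow> degree p \<le> degree q"
    using ex_has_least_nat[of "\<lambda>q. q \<in> W" _ degree] by metis
  define a where "a = lead_coeff p"
  have p: "p \<in> polys_over B" "poly p t \<in> P" and a: "a \<in> B" "a \<notin> P"
    using pW by (auto simp: W_def a_def polys_over_def)
  \<comment> \<open>If some coefficient were outside \<open>P\<close>, trimming \<open>r\<close>
    would put a polynomial of degree below that of \<open>p\<close> into \<open>W\<close>.\<close>
  have p_min: "coeff r j \<in> P"
    if "r \<in> polys_over B" "poly r t \<in> P" "r = 0 \<or> degree r < degree p" for r j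
    using trimW[OF that(1,2)] p_least that(3) prime_ideal_0[OF P] by fastforce

  \<comment> \<open>These represent the multiples of U(t) that are nonzero modulo \<open>P\<close>.
    If \<open>t\<close> is algebraic over a field, U(t) is invertible and the least degree is 0; the
    aim is to prove the same here.\<close>
  define Q where "Q = {q \<in> polys_over B. poly q t \<notin> P \<and>
    (\<exists>w\<in>polys_over B. poly q t - poly U t * poly w t \<in> P)}"
  have "U \<in> Q"
    using U u prime_ideal_0[OF P] polys_over_const[OF B subring_1[OF B]]
    by (auto simp: Q_def intro!: bexI[of _ "[:1:]"])
  then obtain q1 where q1: "q1 \<in> Q" and q1_least: "\<And>q. q \<in> Q \<Longrightarrow> degree q1 \<le> degree q"
    using ex_has_least_nat[of "\<lambda>q. q \<in> Q" _ degree] by metis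
  obtain j where "coeff q1 j \<notin> P"
    using poly_in_prime_ideal[OF P] q1 by (auto simp: Q_def)
  \<comment> \<open>Trimming changes the value only by an element of \<open>P\<close>, so
    \<open>q0\<close> inherits minimality and the congruence from \<open>q1\<close>, now with
    leading coefficient outside \<open>P\<close>.\<close>
  then obtain q0 where q0: "q0 \<in> polys_over B" "lead_coeff q0 \<notin> P" "degree q0 \<le> degree q1"
    "poly q0 t - poly q1 t \<in> P"
    using trim_mod_prime_ideal[OF P B, of q1 j] q1 unfolding Q_def by blast
  define b where "b = lead_coeff q0"
  have b: "b \<in> B" "b \<notin> P" using q0 by (auto simp: b_def polys_over_def)
  have q0_least: "degree q0 \<le> degree q" if "q \<in> Q" for q
    using q1_least[OF that] q0(3) by linarith
  obtain w where w: "w \<in> polys_over B" "poly q1 t - poly U t * poly w t \<in> P"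
    using q1 by (auto simp: Q_def)
  have "(poly q0 t - poly q1 t) + (poly q1 t - poly U t * poly w t) \<in> P"
    using prime_ideal_add[OF P] q0(4) w(2) by blast
  then have w': "poly q0 t - poly U t * poly w t \<in> P" by simp
  have q0t: "poly q0 t \<notin> P"
  proof
    assume "poly q0 t \<in> P"
    then have "poly q0 t - (poly q0 t - poly q1 t) \<in> P" using prime_ideal_diff[OF P] q0(4) by blast
    then show False using q1 by (simp add: Q_def)
  qed

  \<comment> \<open>Pseudo-dividing \<open>q0\<close> by \<open>p\<close> leaves a remainder with
    value a^N q0(t) modulo \<open>P\<close>. It is again in \<open>Q\<close>, and its degree is
    below that of \<open>p\<close>.\<close>
  have "degree q0 < degree p"
  proof -
    obtain N s r where div: "smult (a ^ N) q0 = p * s + r" "s \<in> polys_over B" "r \<in> polys_over B"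
      "r = 0 \<or> degree r < degree p"
      using pseudo_division_over[OF B p(1) q0(1)] unfolding a_def by blast
    have eq: "a ^ N * poly q0 t = poly p t * poly s t + poly r t"
      using arg_cong[OF div(1), of "\<lambda>q. poly q t"] by simp
    have "poly p t * poly s t \<in> P" using p prime_ideal_mult_right[OF P] by blast
    moreover have "a ^ N * poly q0 t \<notin> P"
      using prime_ideal_mult_iff[OF P] prime_ideal_power[OF P] a q0t by blast
    ultimately have rt: "poly r t \<notin> P" using eq prime_ideal_add[OF P] by metis
    have rt_eq: "poly r t = a ^ N * poly q0 t - poly p t * poly s t" using eq by simp
    have "poly r t - poly U t * poly (smult (a ^ N) w) t
        = a ^ N * (poly q0 t - poly U t * poly w t) - poly p t * poly s t"
      unfolding rt_eq by (simp add: algebra_simps del: ring_ideal.scale_scale)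
    also have "\<dots> \<in> P"
      by (rule prime_ideal_diff[OF P prime_ideal_mult_left[OF P w'] \<open>poly p t * poly s t \<in> P\<close>])
    finally have "r \<in> Q"
      using rt div(3) polys_over_smult[OF B subring_power[OF B a(1)] w(1)]
      unfolding Q_def by blast
    then show ?thesis using q0_least div(4) rt prime_ideal_0[OF P] by fastforce
  qed
  \<comment> \<open>Otherwise pseudo-divide \<open>p\<close> by \<open>q0\<close>. Minimality of
    \<open>q0\<close> forces r(t) into \<open>P\<close>, primality then forces s(t) into
    \<open>P\<close>, and since \<open>s\<close> has smaller degree than \<open>p\<close>, all its
    coefficients lie in \<open>P\<close>. Comparing coefficients in the degree of \<open>p\<close>
    puts b^N a into \<open>P\<close>.\<close>
  have "degree q0 = 0"
  proof (rule ccontr)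
    assume pos: "degree q0 \<noteq> 0"
    obtain N s r where div: "smult (b ^ N) p = q0 * s + r" "s \<in> polys_over B" "r \<in> polys_over B"
      "degree s \<le> degree p - degree q0" "r = 0 \<or> degree r < degree q0"
      using pseudo_division_over[OF B q0(1) p(1)] unfolding b_def by blast
    have eq: "b ^ N * poly p t = poly q0 t * poly s t + poly r t"
      using arg_cong[OF div(1), of "\<lambda>q. poly q t"] by simp
    have bp: "b ^ N * poly p t \<in> P" using p prime_ideal_mult_left[OF P] by blast
    have rt: "poly r t \<in> P"
    proof (rule ccontr)
      assume rt: "poly r t \<notin> P"
      have rt_eq: "poly r t = b ^ N * poly p t - poly q0 t * poly s t" using eq by simp
      \<comment> \<open>Modulo \<open>P\<close>, r(t) is -q0(t) s(t) and q0(t) is U(t) w(t), whence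
        the cofactor \<open>0 - s * w\<close>.\<close>
      have "poly r t - poly U t * poly (0 - s * w) t
          = b ^ N * poly p t - (poly q0 t - poly U t * poly w t) * poly s t"
        unfolding rt_eq by (simp add: algebra_simps del: ring_ideal.scale_scale)
      also have "\<dots> \<in> P" by (rule prime_ideal_diff[OF P bp prime_ideal_mult_right[OF P w']])
      finally have "r \<in> Q"
        using rt div(2,3) w(1) B polys_over_diff[OF B polys_over_0[OF B] polys_over_mult[OF B]]
        unfolding Q_def by blast
      then show False using q0_least div(5) rt prime_ideal_0[OF P] by fastforce
    qed
    have "poly q0 t * poly s t \<in> P"
      using eq bp rt prime_ideal_diff[OF P] by (metis add_diff_cancel_right')
    then have "poly s t \<in> P" using q0t prime_ideal_mult_iff[OF P] by blast
    moreover have "degree s < degree p" using div(4) pos \<open>degree q0 < degree p\<close> by linarith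
    ultimately have s: "coeff s j \<in> P" for j using p_min div(2) by blast
    have "coeff r (degree p) = 0"
      using div(5) \<open>degree q0 < degree p\<close> by (auto intro: coeff_eq_0)
    then have "b ^ N * a = coeff (q0 * s) (degree p)"
      using arg_cong[OF div(1), of "\<lambda>q. coeff q (degree p)"] by (simp add: a_def)
    also have "\<dots> \<in> P"
      unfolding coeff_mult using P s by (intro prime_ideal_sum prime_ideal_mult_left)
    finally show False
      using a b prime_ideal_mult_iff[OF P] prime_ideal_power[OF P] by blast
  qed
  then have q0_const: "q0 = [:b:]"
    unfolding b_def by (metis degree_eq_zeroE coeff_pCons_0 degree_pCons_0)

  show ?thesis
  \<comment> \<open>The factor \<open>a\<close> keeps the image of \<open>p\<close> at positive
    degree, so that it has a root, and makes powers of \<open>a\<close> cancellable; the factor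
    \<open>b\<close> keeps the value of \<open>U\<close> at that root nonzero.\<close>
  proof (rule that[of "a * b"])
    show "a * b \<in> B" using subring_mult[OF B] a b by blast
    show "a * b \<notin> P" using prime_ideal_mult_iff[OF P] a b by blast
    fix \<phi> :: "'a \<Rightarrow> 'k"
    assume \<phi>: "ring_hom \<phi>" and ker: "\<And>b. b \<in> B \<Longrightarrow> b \<in> P \<Longrightarrow> \<phi> b = 0" and v: "\<phi> (a * b) \<noteq> 0"
    have nz: "\<phi> a \<noteq> 0" "\<phi> b \<noteq> 0" using v by (auto simp: ring_hom_mult[OF \<phi>])
    have "degree (map_poly \<phi> p) \<ge> degree p"
      using nz(1) by (intro le_degree) (simp add: coeff_map_poly ring_hom_0[OF \<phi>] a_def)
    then obtain t0 where t0: "poly (map_poly \<phi> p) t0 = 0"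
      using alg_closed_imp_poly_has_root \<open>degree q0 < degree p\<close>
      by (metis gr_implies_not0 gr_zeroI le_zero_eq)
    \<comment> \<open>Up to a power of \<open>a\<close>, the relation \<open>q\<close> is a multiple
      of \<open>p\<close> plus a relation of smaller degree, whose coefficients lie in
      \<open>P\<close> and are killed by \<phi>.\<close>
    have vanish: "poly (map_poly \<phi> q) t0 = 0" if q: "q \<in> polys_over B" "poly q t \<in> P" for q
    proof -
      obtain N s r where div: "smult (a ^ N) q = p * s + r" "r \<in> polys_over B"
        "r = 0 \<or> degree r < degree p"
        using pseudo_division_over[OF B p(1) q(1)] unfolding a_def by blast
      have "poly r t = a ^ N * poly q t - poly p t * poly s t"
        using arg_cong[OF div(1), of "\<lambda>q. poly q t"] by simp
      also have "\<dots> \<in> P"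
        by (rule prime_ideal_diff[OF P prime_ideal_mult_left[OF P q(2)] prime_ideal_mult_right[OF P p(2)]])
      finally have "coeff r j \<in> P" for j using p_min div(2,3) by blast
      then have "map_poly \<phi> r = 0"
        using div(2) ker
        by (intro poly_eqI) (auto simp: coeff_map_poly ring_hom_0[OF \<phi>] polys_over_def)
      then have "smult (\<phi> a ^ N) (map_poly \<phi> q) = map_poly \<phi> p * map_poly \<phi> s"
        using arg_cong[OF div(1), of "map_poly \<phi>"]
        by (simp add: map_poly_hom_smult[OF \<phi>] map_poly_hom_add[OF \<phi>] map_poly_hom_mult[OF \<phi>]
            ring_hom_power[OF \<phi>])
      then have "\<phi> a ^ N * poly (map_poly \<phi> q) t0 = 0"
        using t0 by (metis mult_zero_left poly_mult poly_smult)
      then show ?thesis using nz(1) by simp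
    qed
    \<comment> \<open>This difference is itself a relation; its image at \<open>t0\<close> makes the
      value of \<open>U\<close> a factor of the nonzero \<open>\<phi> b\<close>.\<close>
    have "q0 - U * w \<in> polys_over B" using B q0 U w by (intro polys_over_diff polys_over_mult)
    then have "poly (map_poly \<phi> (q0 - U * w)) t0 = 0" using vanish w' by simp
    then have "poly (map_poly \<phi> U) t0 * poly (map_poly \<phi> w) t0 = \<phi> b"
      by (simp add: map_poly_hom_diff[OF \<phi>] map_poly_hom_mult[OF \<phi>] q0_const
          map_poly_pCons ring_hom_0[OF \<phi>])
    then have "poly (map_poly \<phi> U) t0 \<noteq> 0" using nz(2) by auto
    with vanish show "\<exists>t0. (\<forall>q\<in>polys_over B. poly q t \<in> P \<longrightarrow> poly (map_poly \<phi> q) t0 = 0)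
        \<and> poly (map_poly \<phi> U) t0 \<noteq> 0" by blast
  qed
qed


section \<open>The affine Nullstellensatz\<close>

text \<open>The subalgebra k[x_i : i in S] is described by generators so that inserting an index
  amounts to adjoining one element.\<close>

inductive_set polys_in :: "'n set \<Rightarrow> ('n, 'k::comm_ring_1) mvpoly set" for S where
  const: "Poly_Mapping.single 0 c \<in> polys_in S"
| var: "i \<in> S \<Longrightarrow> var i \<in> polys_in S"
| add: "f \<in> polys_in S \<Longrightarrow> g \<in> polys_in S \<Longrightarrow> f + g \<in> polys_in S"
| mult: "f \<in> polys_in S \<Longrightarrow> g \<in> polys_in S \<Longrightarrow> f * g \<in> polys_in S"

lemma subring_polys_in: "subring (polys_in S)"
proof -
  have "1 \<in> polys_in S" using polys_in.const[of 1] by simp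
  moreover have "f - g \<in> polys_in S" if "f \<in> polys_in S" "g \<in> polys_in S" for f g
  proof -
    have "f - g = f + Poly_Mapping.single 0 (- 1) * g" by (simp add: single_uminus)
    then show ?thesis using that polys_in.const polys_in.add polys_in.mult by metis
  qed
  ultimately show ?thesis by (auto simp: subring_def intro: polys_in.mult)
qed

lemma single_in_polys_in: "Poly_Mapping.single m c \<in> polys_in (UNIV :: 'n::finite set)"
proof -
  have power: "Poly_Mapping.single (Poly_Mapping.single i k) (1::'a) = var i ^ k" for i :: 'n and k
  proof (induction k)
    case (Suc k)
    have eq: "Poly_Mapping.single i (Suc k) = Poly_Mapping.single i 1 + Poly_Mapping.single i k"
      by (simp flip: single_add)
    have "Poly_Mapping.single (Poly_Mapping.single i (Suc k)) (1::'a)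
        = var i * Poly_Mapping.single (Poly_Mapping.single i k) 1"
      by (simp only: var_def mult_single eq mult_1)
    then show ?case using Suc by simp
  qed simp
  have 1: "Poly_Mapping.single m (1::'a) \<in> polys_in UNIV" for m :: "'n \<Rightarrow>\<^sub>0 nat"
  proof (induction m rule: update_induct)
    case const
    show ?case by (rule polys_in.const)
  next
    case (update m i k)
    have "Poly_Mapping.update i k m = Poly_Mapping.single i k + m"
      using update.hyps
      by (intro poly_mapping_eqI) (auto simp: lookup_update lookup_add lookup_single when_def in_keys_iff)
    then have "Poly_Mapping.single (Poly_Mapping.update i k m) (1::'a)
        = var i ^ k * Poly_Mapping.single m 1"
      by (simp add: power[symmetric] mult_single)
    then show ?case
      using update.IH by (auto intro!: polys_in.mult subring_power subring_polys_in polys_in.var)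
  qed
  have "Poly_Mapping.single m c = Poly_Mapping.single 0 c * Poly_Mapping.single m 1"
    by (simp add: mult_single)
  then show ?thesis using polys_in.mult[OF polys_in.const 1] by metis
qed

lemma polys_in_UNIV: "f \<in> polys_in (UNIV :: 'n::finite set)"
proof (induction f rule: mvpoly_induct)
  case zero
  show ?case using subring_0[OF subring_polys_in] .
next
  case (add f m c)
  then show ?case by (intro polys_in.add single_in_polys_in)
qed

lemma polys_in_empty:
  assumes "f \<in> polys_in {}"
  obtains c where "f = Poly_Mapping.single 0 c"
proof -
  have "\<exists>c. f = Poly_Mapping.single 0 c"
    using assms by induction (auto simp: mult_single single_add[symmetric])
  then show ?thesis using that by blast
qed

text \<open>This writes elements in the form B[t] with B = \<open>polys_in S\<close> and t =
  \<open>var i\<close>, as \<open>extend_hom_to_adjunction\<close> expects.\<close>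

lemma polys_in_insert:
  assumes "f \<in> polys_in (insert i S)"
  obtains q where "q \<in> polys_over (polys_in S)" "f = poly q (var i)"
proof -
  note B = subring_polys_in[of S]
  have "\<exists>q. q \<in> polys_over (polys_in S) \<and> f = poly q (var i)"
    using assms
  proof induction
    case (const c)
    then show ?case
      using polys_over_const[OF B polys_in.const] by (intro exI[of _ "[:Poly_Mapping.single 0 c:]"]) auto
  next
    case (var j)
    show ?case
    proof (cases "j = i")
      case True
      then show ?thesis
        using polys_over_monom[OF B subring_1[OF B], of 1]
        by (intro exI[of _ "monom 1 1"]) (auto simp: poly_monom)
    next
      case False
      then show ?thesis
        using var polys_over_const[OF B polys_in.var] by (intro exI[of _ "[:var j:]"]) auto
    qed
  next
    case (add f g)
    then show ?case using polys_over_add[OF B] by (metis poly_add)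
  next
    case (mult f g)
    then show ?case using polys_over_mult[OF B] by (metis poly_mult)
  qed
  then show ?thesis using that by blast
qed

lemma mv_eval_const [simp]: "mv_eval (Poly_Mapping.single 0 c) x = c"
  by (simp add: monom_eval_def)

lemma ring_hom_mv_eval: "ring_hom (\<lambda>f. mv_eval f x)"
  using mv_eval_const[of 1 x] by (simp add: ring_hom_def mv_eval_add mv_eval_mult)

text \<open>Coordinates outside \<open>S\<close> can be reset without disturbing what is already
  arranged over \<open>polys_in S\<close>.\<close>

lemma mv_eval_cong_polys_in:
  assumes "f \<in> polys_in S" "\<And>i. i \<in> S \<Longrightarrow> x $ i = y $ i"
  shows "mv_eval f x = mv_eval f y"
  using assms by induction (simp_all del: mv_eval_single add: mv_eval_add mv_eval_mult)

text \<open>Induction on \<open>S\<close>: eliminating \<open>var i\<close> turns \<open>f\<close>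
  into an element \<open>v\<close> over the remaining variables, the induction hypothesis for
  \<open>v\<close> fixes the other coordinates, and the extension property supplies coordinate
  \<open>i\<close>.\<close>

lemma prime_ideal_zero_avoiding:
  fixes P :: "('n::finite, 'k::alg_closed_field) mvpoly set"
  assumes P: "prime_ideal P" and "finite S" "f \<in> polys_in S" "f \<notin> P"
  shows "\<exists>x. (\<forall>g\<in>polys_in S. g \<in> P \<longrightarrow> mv_eval g x = 0) \<and> mv_eval f x \<noteq> 0"
  using assms(2-)
proof (induction S arbitrary: f)
  case empty
  \<comment> \<open>A nonzero constant is a unit, and \<open>P\<close> is proper.\<close>
  have zero: "c = 0" if "Poly_Mapping.single 0 c \<in> P" for c :: 'k
  proof (rule ccontr)
    assume "c \<noteq> 0"
    moreover have "Poly_Mapping.single 0 (inverse c) * Poly_Mapping.single 0 c \<in> P"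
      using prime_ideal_mult_left[OF P that] .
    ultimately show False using prime_ideal_1[OF P] by (simp add: mult_single)
  qed
  obtain c where c: "f = Poly_Mapping.single 0 c" using empty(1) by (rule polys_in_empty)
  then have "c \<noteq> 0" using empty prime_ideal_0[OF P] by auto
  moreover have "mv_eval g 0 = 0" if "g \<in> polys_in {}" "g \<in> P" for g
    using that zero by (metis mv_eval_const polys_in_empty)
  ultimately show ?case using c by (intro exI[of _ 0]) (simp del: mv_eval_single)
next
  case (insert i S)
  obtain U where U: "U \<in> polys_over (polys_in S)" "f = poly U (var i)"
    using insert.prems(1) by (rule polys_in_insert)
  have u: "poly U (var i) \<notin> P" using insert.prems U by simp
  from extend_hom_to_adjunction[OF subring_polys_in P U(1) u, where ?'k = 'k]
  obtain v where v: "v \<in> polys_in S" "v \<notin> P"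
    and ext: "\<And>\<phi> :: ('n, 'k) mvpoly \<Rightarrow> 'k. ring_hom \<phi> \<Longrightarrow>
      (\<And>b. b \<in> polys_in S \<Longrightarrow> b \<in> P \<Longrightarrow> \<phi> b = 0) \<Longrightarrow> \<phi> v \<noteq> 0 \<Longrightarrow>
      \<exists>t0. (\<forall>q\<in>polys_over (polys_in S). poly q (var i) \<in> P \<longrightarrow> poly (map_poly \<phi> q) t0 = 0)
        \<and> poly (map_poly \<phi> U) t0 \<noteq> 0" by blast
  obtain x where x: "\<And>g. g \<in> polys_in S \<Longrightarrow> g \<in> P \<Longrightarrow> mv_eval g x = 0" "mv_eval v x \<noteq> 0"
    using insert.IH[OF v] by blast
  obtain t0 where t0: "\<And>q. q \<in> polys_over (polys_in S) \<Longrightarrow> poly q (var i) \<in> P \<Longrightarrow>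
      poly (map_poly (\<lambda>f. mv_eval f x) q) t0 = 0" "poly (map_poly (\<lambda>f. mv_eval f x) U) t0 \<noteq> 0"
    using ext[OF ring_hom_mv_eval, of x] x by blast
  \<comment> \<open>As \<open>i\<close> is not in \<open>S\<close>, elements of
    \<open>polys_in S\<close> have the same value at \<open>y\<close> as at \<open>x\<close>, while
    \<open>var i\<close> now takes the value \<open>t0\<close>.\<close>
  define y where "y = (\<chi> j. if j = i then t0 else x $ j)"
  have y: "mv_eval (poly q (var i)) y = poly (map_poly (\<lambda>f. mv_eval f x) q) t0"
    if "q \<in> polys_over (polys_in S)" for q
  proof -
    have "mv_eval (coeff q j) y = mv_eval (coeff q j) x" for j
      using that insert.hyps by (intro mv_eval_cong_polys_in[of _ S]) (auto simp: polys_over_def y_def)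
    then have "map_poly (\<lambda>f. mv_eval f y) q = map_poly (\<lambda>f. mv_eval f x) q"
      by (intro poly_eqI) (simp add: coeff_map_poly)
    then show ?thesis by (simp add: ring_hom_poly[OF ring_hom_mv_eval]) (simp add: y_def)
  qed
  have "mv_eval g y = 0" if "g \<in> polys_in (insert i S)" "g \<in> P" for g
    using that t0(1) y by (metis polys_in_insert)
  moreover have "mv_eval f y \<noteq> 0" using t0(2) y U by simp
  ultimately show ?case by blast
qed

text \<open>If \<open>I\<close> has no zero at all, the premise on \<open>f\<close> is vacuous; with
  f = 1 this is the weak Nullstellensatz.\<close>

theorem affine_nullstellensatz:
  fixes I :: "('n::finite, 'k::alg_closed_field) mvpoly set"
  assumes I: "ring_ideal.subspace I"
    and f: "\<And>x. (\<And>g. g \<in> I \<Longrightarrow> mv_eval g x = 0) \<Longrightarrow> mv_eval f x = 0"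
  shows "f \<in> radical I"
proof (rule ccontr)
  assume nr: "f \<notin> radical I"
  have "f ^ m \<notin> I" for m
  proof
    assume "f ^ m \<in> I"
    \<comment> \<open>The extra factor covers m = 0, because \<open>radical\<close> asks for a
      positive exponent.\<close>
    then have "f ^ Suc m \<in> I" using ring_ideal.subspace_scale[OF I] by simp
    then show False using nr unfolding radical_def by blast
  qed
  then obtain P where P: "prime_ideal P" "I \<subseteq> P" "f \<notin> P"
    using prime_ideal_avoiding_powers[OF I] by blast
  then obtain x where "\<And>g. g \<in> P \<Longrightarrow> mv_eval g x = 0" "mv_eval f x \<noteq> 0"
    using prime_ideal_zero_avoiding[OF P(1) finite polys_in_UNIV P(3)] polys_in_UNIV by blast
  then show False using f P(2) by blast
qed


section \<open>Weighted-homogeneous components\<close>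

definition weighted_component ::
    "('n::finite \<Rightarrow> nat) \<Rightarrow> nat \<Rightarrow> ('n, 'k::comm_ring_1) mvpoly \<Rightarrow> ('n, 'k) mvpoly"
  where "weighted_component a d f =
    (\<Sum>m\<in>{m \<in> Poly_Mapping.keys f. weighted_degree a m = d}.
      Poly_Mapping.single m (Poly_Mapping.lookup f m))"

lemma weighted_homogeneous_component:
  "weighted_homogeneous_of_degree a d (weighted_component a d f)"
proof -
  have "Poly_Mapping.keys (weighted_component a d f)
      \<subseteq> (\<Union>m\<in>{m \<in> Poly_Mapping.keys f. weighted_degree a m = d}.
          Poly_Mapping.keys (Poly_Mapping.single m (Poly_Mapping.lookup f m)))"
    unfolding weighted_component_def by (rule Poly_Mapping.keys_sum)
  then show ?thesis
    by (auto simp: weighted_homogeneous_of_degree_def split: if_splits)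
qed

lemma sum_weighted_components:
  "(\<Sum>d\<in>weighted_degree a ` Poly_Mapping.keys f. weighted_component a d f) = f"
proof -
  have "(\<Sum>d\<in>weighted_degree a ` Poly_Mapping.keys f. weighted_component a d f)
      = (\<Sum>m\<in>Poly_Mapping.keys f. Poly_Mapping.single m (Poly_Mapping.lookup f m))"
    unfolding weighted_component_def by (rule sum.image_gen[symmetric]) simp
  also have "\<dots> = f"
    by (rule poly_mapping_eqI)
      (simp add: lookup_sum lookup_single when_def sum.delta in_keys_iff)
  finally show ?thesis .
qed

text \<open>By homogeneity, \<open>f\<close> at the point scaled by \<open>c\<close> is the sum of
  c^d f_d(x), a polynomial in \<open>c\<close> whose coefficients are the values of the components.
  Every nonzero \<open>c\<close> is a root, and the field is infinite.\<close>

lemma component_vanishes_on_orbit: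
  fixes f :: "('n::finite, 'k::alg_closed_field) mvpoly"
  assumes "\<And>c. c \<noteq> 0 \<Longrightarrow> mv_eval f (weighted_scale a c x) = 0"
    and d: "d \<in> weighted_degree a ` Poly_Mapping.keys f"
  shows "mv_eval (weighted_component a d f) x = 0"
proof -
  let ?D = "weighted_degree a ` Poly_Mapping.keys f"
  define p where "p = (\<Sum>d\<in>?D. monom (mv_eval (weighted_component a d f) x) d)"
  have "poly p c = mv_eval f (weighted_scale a c x)" for c
  proof -
    have "mv_eval f (weighted_scale a c x)
        = (\<Sum>d\<in>?D. mv_eval (weighted_component a d f) (weighted_scale a c x))"
      by (subst (1) sum_weighted_components[of a f, symmetric])
        (rule ring_hom_sum[OF ring_hom_mv_eval])
    also have "\<dots> = poly p c"
      by (simp add: p_def poly_sum poly_monom mult.commute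
          mv_eval_weighted_scale[OF weighted_homogeneous_component])
    finally show ?thesis ..
  qed
  then have "UNIV - {0} \<subseteq> {c. poly p c = 0}" using assms(1) by auto
  moreover have "infinite (UNIV - {0 :: 'k})" using infinite_UNIV_alg_closed_field by simp
  ultimately have "p = 0" using poly_roots_finite finite_subset by blast
  moreover have "coeff p d = mv_eval (weighted_component a d f) x"
    using d by (simp add: p_def coeff_sum sum.delta)
  ultimately show ?thesis by simp
qed


section \<open>The weighted projective Nullstellensatz\<close>

lemma weighted_orbit_in_proj_space:
  assumes "x \<noteq> 0"
  shows "weighted_orbit_rel a `` {x} \<in> weighted_proj_space a" "x \<in> weighted_orbit_rel a `` {x}"
  using assms equiv_class_self[OF equiv_weighted_orbit_rel]
  by (auto simp: weighted_proj_space_def intro: quotientI)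

lemma
  assumes "p \<in> weighted_proj_space a"
  shows weighted_proj_space_nonempty: "p \<noteq> {}"
    and weighted_scale_in_point: "x \<in> p \<Longrightarrow> c \<noteq> 0 \<Longrightarrow> weighted_scale a c x \<in> p"
proof -
  show "p \<noteq> {}"
    using assms in_quotient_imp_non_empty[OF equiv_weighted_orbit_rel]
    by (auto simp: weighted_proj_space_def)
  assume x: "x \<in> p" and c: "c \<noteq> 0"
  have "x \<noteq> 0"
    using assms x in_quotient_imp_subset[OF equiv_weighted_orbit_rel, of p a]
    by (auto simp: weighted_proj_space_def)
  moreover from this have "weighted_scale a c x \<noteq> 0"
    using c by (auto simp: weighted_scale_def vec_eq_iff)
  ultimately have "(x, weighted_scale a c x) \<in> weighted_orbit_rel a"
    using c by (auto simp: weighted_orbit_rel_def)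
  then show "weighted_scale a c x \<in> p"
    using assms x in_quotient_imp_closed[OF equiv_weighted_orbit_rel, of p a x]
    by (simp add: weighted_proj_space_def)
qed

text \<open>Positive weights let the scalar 0 contract \<open>x\<close> to the origin, so f(0) = 0^d
  f(x). In degree 0 it is the zero \<open>x\<close> that excludes nonzero constants.\<close>

lemma weighted_homogeneous_vanishes_at_0:
  fixes f :: "('n::finite, 'k::field) mvpoly"
  assumes "\<And>i. a i > 0" "weighted_homogeneous a f" "mv_eval f x = 0"
  shows "mv_eval f 0 = 0"
proof -
  obtain d where d: "weighted_homogeneous_of_degree a d f"
    using assms(2) by (auto simp: weighted_homogeneous_def)
  have 0: "weighted_scale a 0 x = 0"
    using assms(1) by (simp add: weighted_scale_def vec_eq_iff)
  show ?thesis
    using mv_eval_weighted_scale[OF d, of 0 x] assms(3) by (simp add: 0)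
qed

lemma subspace_weighted_homogeneous_ideal:
  "weighted_homogeneous_ideal a I \<Longrightarrow> ring_ideal.subspace I"
  by (auto simp: weighted_homogeneous_ideal_def)

text \<open>Since \<open>vanishing_ideal\<close> is spanned by weighted-homogeneous polynomials, a
  member of the radical is split into its components. Each of them vanishes on the zero locus
  because points are closed under nonzero scaling.\<close>

lemma radical_subset_vanishing_ideal:
  fixes I :: "('n::finite, 'k::alg_closed_field) mvpoly set"
  shows "radical I \<subseteq> vanishing_ideal a (zero_locus a I)"
proof
  fix f assume "f \<in> radical I"
  then obtain m where m: "f ^ m \<in> I" by (auto simp: radical_def)
  have f0: "mv_eval f x = 0" if "p \<in> zero_locus a I" "x \<in> p" for p x
  proof -
    have "mv_eval (f ^ m) x = 0"
      using that m by (auto simp: zero_locus_def vanishes_at_def)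
    then show ?thesis by (simp add: ring_hom_power[OF ring_hom_mv_eval])
  qed
  have "weighted_component a d f \<in> vanishing_ideal a (zero_locus a I)"
    if d: "d \<in> weighted_degree a ` Poly_Mapping.keys f" for d
  proof -
    have hom: "weighted_homogeneous a (weighted_component a d f)"
      using weighted_homogeneous_component unfolding weighted_homogeneous_def by blast
    have "mv_eval (weighted_component a d f) x = 0" if "p \<in> zero_locus a I" "x \<in> p" for p x
      using that f0 weighted_scale_in_point[of p a x] d
      by (intro component_vanishes_on_orbit) (auto simp: zero_locus_def)
    with hom show ?thesis
      unfolding vanishing_ideal_def
      by (intro ring_ideal.span_base) (auto simp: vanishes_at_def)
  qed
  then have "(\<Sum>d\<in>weighted_degree a ` Poly_Mapping.keys f. weighted_component a d f)
      \<in> vanishing_ideal a (zero_locus a I)"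
    unfolding vanishing_ideal_def by (rule ring_ideal.span_sum)
  then show "f \<in> vanishing_ideal a (zero_locus a I)" by (simp add: sum_weighted_components)
qed

theorem theorem3p2p10:
  fixes a :: "'n::finite \<Rightarrow> nat"
    and I :: "('n, 'k::alg_closed_field) mvpoly set"
  assumes "\<And>i. a i > 0"
    and "weighted_homogeneous_ideal a I"
    and "relevant_ideal a I"
  shows "vanishing_ideal a (zero_locus a I) = radical I"
proof
  show "radical I \<subseteq> vanishing_ideal a (zero_locus a I)"
    by (rule radical_subset_vanishing_ideal)
  show "vanishing_ideal a (zero_locus a I) \<subseteq> radical I"
  proof
    fix f assume f: "f \<in> vanishing_ideal a (zero_locus a I)"
    \<comment> \<open>Relevance supplies a point of the zero locus. The generators of the vanishing
      ideal vanish there, which decides their value at the origin.\<close>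
    obtain p0 x0 where p0: "p0 \<in> zero_locus a I" "x0 \<in> p0"
      using assms(3) weighted_proj_space_nonempty[of _ a]
      by (fastforce simp: relevant_ideal_def zero_locus_def)
    show "f \<in> radical I"
    proof (rule affine_nullstellensatz)
      show "ring_ideal.subspace I" using assms(2) by (rule subspace_weighted_homogeneous_ideal)
      fix x assume x: "\<And>g. g \<in> I \<Longrightarrow> mv_eval g x = 0"
      \<comment> \<open>An affine zero \<open>x\<close> of \<open>I\<close> may be the origin, which
        represents no projective point; any other \<open>x\<close> lies on an orbit that belongs to
        the zero locus.\<close>
      have gen: "mv_eval g x = 0"
        if g: "weighted_homogeneous a g" "\<forall>p\<in>zero_locus a I. vanishes_at g p" for g
      proof (cases "x = 0")
        case True
        have "mv_eval g x0 = 0" using g(2) p0 by (auto simp: vanishes_at_def)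
        then show ?thesis
          using weighted_homogeneous_vanishes_at_0[OF assms(1) g(1)] True by simp
      next
        case False
        note p = weighted_orbit_in_proj_space[OF False, of a]
        have "weighted_orbit_rel a `` {x} \<in> zero_locus a I"
          using in_zero_locus_iff[OF p assms(2)] x by blast
        then show ?thesis using g(2) p(2) unfolding vanishes_at_def by blast
      qed
      show "mv_eval f x = 0"
        using f unfolding vanishing_ideal_def
        by (induction rule: ring_ideal.span_induct_alt) (auto simp: gen mv_eval_add mv_eval_mult)
    qed
  qed
qed

end
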